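(* For the infinite hexagonal grid $HEX$, the minimum density of a RED:LD set is $\textrm{RED:LD}\%(HEX) = \frac{1}{2}$.
   Context: $HEX$ is the infinite 3-regular hexagonal (honeycomb) grid graph. $N(v)$ denotes the open neighborhood of $v$. A set $S \subseteq V(G)$ is a locating-dominating (LD) set if for all $u,v \in V(G)-S$: $N(v)\cap S \neq \varnothing$, and if $u \ne v$ then $N(v) \cap S \neq N(u) \cap S$. A RED:LD set is an LD set $S$ such that $S-\{v\}$ is an LD set for every $v \in S$. For an infinite graph, the density of $S$ is the ratio of the number of detectors to the number of vertices (in the usual limiting sense), and $\textrm{RED:LD}\%(G)$ is the minimum density of a RED:LD set. *)

theory Defs
  imports Complex_Main "HOL-Library.Extended_Real" "HOL-Library.Liminf_Limsup"
begin

text \<open>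
  A simple graph is given by its adjacency relation, a symmetric irreflexive set of pairs; its
  vertices are all elements of the underlying type.
\<close>

definition nbhd :: "'a rel \<Rightarrow> 'a \<Rightarrow> 'a set" where
  "nbhd E v = {u. (v, u) \<in> E}"

definition graph_ball :: "'a rel \<Rightarrow> 'a \<Rightarrow> nat \<Rightarrow> 'a set" where
  "graph_ball E v r = {u. \<exists>n\<le>r. (v, u) \<in> E ^^ n}"

definition LD_set :: "'a rel \<Rightarrow> 'a set \<Rightarrow> bool" where
  "LD_set E S \<longleftrightarrow>
     (\<forall>u v. u \<notin> S \<longrightarrow> v \<notin> S \<longrightarrow>
        nbhd E v \<inter> S \<noteq> {} \<and> (u \<noteq> v \<longrightarrow> nbhd E v \<inter> S \<noteq> nbhd E u \<inter> S))"

definition RED_LD_set :: "'a rel \<Rightarrow> 'a set \<Rightarrow> bool" where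
  "RED_LD_set E S \<longleftrightarrow> LD_set E S \<and> (\<forall>v\<in>S. LD_set E (S - {v}))"

text \<open>
  The usual density in an infinite, locally finite graph: the upper limit of the proportion of
  detectors in the balls around a vertex, maximised over the centre so that no base point has to
  be chosen.
\<close>

definition graph_density :: "'a rel \<Rightarrow> 'a set \<Rightarrow> ereal" where
  "graph_density E S =
     (SUP v. limsup (\<lambda>r. ereal (real (card (S \<inter> graph_ball E v r)) / real (card (graph_ball E v r)))))"

definition is_RED_LD_density :: "'a rel \<Rightarrow> ereal \<Rightarrow> bool" where
  "is_RED_LD_density E d \<longleftrightarrow>
     (\<exists>S. RED_LD_set E S \<and> graph_density E S = d) \<and> (\<forall>S. RED_LD_set E S \<longrightarrow> d \<le> graph_density E S)"

text \<open>
  The honeycomb drawn as a brick wall: every horizontal edge of the integer grid is kept, and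
  the vertical edge between \<open>(x, y)\<close> and \<open>(x, y + 1)\<close> is kept iff \<open>x + y\<close> is even.
\<close>

definition HEX :: "(int \<times> int) rel" where
  "HEX = {((x, y), (x', y')).
            (y' = y \<and> \<bar>x' - x\<bar> = 1) \<or>
            (x' = x \<and> ((even (x + y) \<and> y' = y + 1) \<or> (odd (x + y) \<and> y' = y - 1)))}"

lemma nbhd_HEX:
  "nbhd HEX (x, y) = {(x - 1, y), (x + 1, y), (x, if even (x + y) then y + 1 else y - 1)}"
  by (auto simp: nbhd_def HEX_def)

lemma card_nbhd_HEX: "card (nbhd HEX v) = 3"
  by (cases v) (simp add: nbhd_HEX)

lemma sym_HEX: "sym HEX"
  by (auto simp: sym_def HEX_def)

lemma irrefl_HEX: "irrefl HEX"
  by (auto simp: irrefl_def HEX_def)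

end

theory Submission
  imports Defs "HOL-Analysis.Extended_Real_Limits" "HOL-Real_Asymp.Real_Asymp"
begin

text \<open>
  In a RED:LD set every detector has a neighbouring detector and every non-detector has two of
  them.  Counting the pairs consisting of a vertex of a ball and a neighbouring detector, and
  using that each detector has degree 3, gives \<open>3|S| \<ge> |S| + 2(n - |S|)\<close> up to a boundary term,
  that is \<open>|S| \<ge> n / 2\<close>.  Equality is attained by the columns of even abscissa: every vertex then
  has exactly one neighbour in its own class, joined to it by a vertical edge.  The boundary terms
  vanish in the limit because the balls of the honeycomb grow quadratically.
\<close>

section \<open>Redundant locating-dominating sets in cubic graphs\<close>

text \<open>Once \<open>v\<close> is deleted it is itself a non-detector, so another detector must
  dominate it.\<close>

lemma RED_LD_set_detector:
  assumes "RED_LD_set E S" "v \<in> S"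
  shows "nbhd E v \<inter> S \<noteq> {}"
proof -
  have "LD_set E (S - {v})"
    using assms by (auto simp: RED_LD_set_def)
  then have "nbhd E v \<inter> (S - {v}) \<noteq> {}"
    unfolding LD_set_def by blast
  then show ?thesis by blast
qed

text \<open>Deleting one detector next to \<open>v\<close> must leave \<open>v\<close> dominated,
  which supplies a second one.\<close>

lemma RED_LD_set_nondetector:
  assumes "RED_LD_set E S" "v \<notin> S" "finite (nbhd E v)"
  shows "2 \<le> card (nbhd E v \<inter> S)"
proof -
  have "LD_set E S"
    using assms by (auto simp: RED_LD_set_def)
  with assms obtain w where w: "w \<in> nbhd E v \<inter> S"
    unfolding LD_set_def by blast
  then have "LD_set E (S - {w})"
    using assms by (auto simp: RED_LD_set_def)
  with assms obtain z where z: "z \<in> nbhd E v \<inter> (S - {w})"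
    unfolding LD_set_def by blast
  have "card {w, z} \<le> card (nbhd E v \<inter> S)"
    using w z assms by (intro card_mono) auto
  then show ?thesis using z by (cases "w = z") auto
qed

lemma graph_ball_mono: "r \<le> s \<Longrightarrow> graph_ball E v r \<subseteq> graph_ball E v s"
  unfolding graph_ball_def using order_trans by blast

lemma nbhd_subset_graph_ball_Suc:
  assumes "u \<in> graph_ball E v r"
  shows "nbhd E u \<subseteq> graph_ball E v (Suc r)"
proof
  fix w assume "w \<in> nbhd E u"
  moreover obtain n where "n \<le> r" "(v, u) \<in> E ^^ n"
    using assms by (auto simp: graph_ball_def)
  ultimately have "(v, w) \<in> E ^^ Suc n" "Suc n \<le> Suc r"
    by (auto simp: nbhd_def)
  then show "w \<in> graph_ball E v (Suc r)"
    unfolding graph_ball_def by blast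
qed

lemma RED_LD_set_card_ball:
  assumes S: "RED_LD_set E S" and "sym E"
    and fin: "\<And>r. finite (graph_ball E v r)" and cubic: "\<And>u. card (nbhd E u) = 3"
  shows "card (graph_ball E v r) \<le> 2 * card (S \<inter> graph_ball E v (Suc r))"
proof -
  let ?B = "graph_ball E v r" and ?B' = "graph_ball E v (Suc r)"
  have fin_nbhd: "finite (nbhd E u)" for u
    using cubic[of u] by (intro card_ge_0_finite) simp
  have dom: "(if u \<in> S then 1 else 2) \<le> card (nbhd E u \<inter> S)" for u
    using RED_LD_set_detector[OF S, of u] RED_LD_set_nondetector[OF S _ fin_nbhd, of u]
      fin_nbhd[of u]
    by (auto simp: Suc_le_eq card_gt_0_iff)
  have "(\<Sum>u\<in>?B. if u \<in> S then 1 else 2) \<le> (\<Sum>u\<in>?B. card (nbhd E u \<inter> S))"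
    by (intro sum_mono dom)
  also have "\<dots> = card (SIGMA u:?B. nbhd E u \<inter> S)"
    using fin fin_nbhd by (simp add: card_SigmaI)
  \<comment> \<open>Swapping the pairs regroups the count by detector. Neighbours of the smaller
    ball lie in the ball of radius \<open>Suc r\<close>.\<close>
  also have "\<dots> = card (prod.swap ` (SIGMA u:?B. nbhd E u \<inter> S))"
    by (simp add: card_image)
  also have "\<dots> \<le> card (SIGMA w:S \<inter> ?B'. nbhd E w)"
  proof (rule card_mono)
    show "finite (SIGMA w:S \<inter> ?B'. nbhd E w)"
      using fin fin_nbhd by auto
    show "prod.swap ` (SIGMA u:?B. nbhd E u \<inter> S) \<subseteq> (SIGMA w:S \<inter> ?B'. nbhd E w)"
      using nbhd_subset_graph_ball_Suc[of _ E v r] \<open>sym E\<close>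
      by (fastforce simp: nbhd_def dest: symD)
  qed
  also have "\<dots> = 3 * card (S \<inter> ?B')"
    using fin fin_nbhd cubic by (simp add: card_SigmaI)
  finally have "(\<Sum>u\<in>?B. if u \<in> S then 1 else 2) \<le> 3 * card (S \<inter> ?B')" .
  moreover have "(\<Sum>u\<in>?B. if u \<in> S then 1 else 2) = card (?B \<inter> S) + 2 * card (?B - S)"
    using fin by (simp add: sum.If_cases Diff_eq)
  moreover have "card ?B = card (?B \<inter> S) + card (?B - S)"
    using fin by (metis card_Int_Diff)
  moreover have "card (?B \<inter> S) \<le> card (S \<inter> ?B')"
    using fin graph_ball_mono[of r "Suc r" E v] by (intro card_mono) auto
  \<comment> \<open>Adding the last inequality to the double count gives
    \<open>2 * card ?B \<le> 4 * card (S \<inter> ?B')\<close>.\<close>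
  ultimately show ?thesis by linarith
qed

section \<open>Balls in the honeycomb\<close>

text \<open>
  The parity correction makes the height change by exactly 1 along every edge, vertical ones
  included, so that it bounds the graph distance from below just as the taxicab distance does.
  The larger of the two bounds is the graph distance.
\<close>

definition hex_height :: "int \<times> int \<Rightarrow> int" where
  "hex_height p = 2 * snd p - (fst p + snd p) mod 2"

definition hex_dist :: "int \<times> int \<Rightarrow> int \<times> int \<Rightarrow> int" where
  "hex_dist v p =
     max (\<bar>fst p - fst v\<bar> + \<bar>snd p - snd v\<bar>) \<bar>hex_height p - hex_height v\<bar>"

lemma hex_dist_edge:
  assumes "(p, q) \<in> HEX"
  shows "hex_dist v q \<le> hex_dist v p + 1"
proof -
  have "\<bar>hex_height q - hex_height p\<bar> \<le> 1"
  proof -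
    obtain x y x' y' where pq: "p = (x, y)" "q = (x', y')" by force
    have mod2: "0 \<le> s mod 2 \<and> s mod 2 \<le> 1" for s :: int by simp
    consider "y' = y" | "x' = x" "y' = y + 1" "even (x + y)" | "x' = x" "y' = y - 1" "odd (x + y)"
      using assms unfolding pq HEX_def by blast
    then show ?thesis
    proof cases
      case 1
      then show ?thesis
        using mod2[of "x + y"] mod2[of "x' + y"] by (simp add: pq hex_height_def)
    next
      \<comment> \<open>The row term changes by 2 and the parity term gives back 1; likewise in case
        3.\<close>
      case 2
      then have "(x + y) mod 2 = 0" "(x + (y + 1)) mod 2 = 1" by presburger+
      with 2 show ?thesis by (simp add: pq hex_height_def)
    next
      case 3
      then have "(x + y) mod 2 = 1" "(x + (y - 1)) mod 2 = 0" by presburger+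
      with 3 show ?thesis by (simp add: pq hex_height_def)
    qed
  qed
  moreover have "\<bar>fst q - fst p\<bar> + \<bar>snd q - snd p\<bar> \<le> 1"
    using assms by (auto simp: HEX_def)
  ultimately show ?thesis
    unfolding hex_dist_def by (smt (verit))
qed

text \<open>The step follows the vertical edge if that leads towards the row of \<open>v\<close>,
  and goes sideways otherwise.\<close>

lemma hex_dist_descent:
  assumes "p \<noteq> v"
  shows "\<exists>q. (q, p) \<in> HEX \<and> hex_dist v q < hex_dist v p"
proof -
  obtain a b x y where v: "v = (a, b)" and p: "p = (x, y)" by force
  define i where "i = (a + b) mod 2"
  have i: "i = 0 \<or> i = 1" unfolding i_def by presburger
  have ne: "x \<noteq> a \<or> y \<noteq> b" using assms v p by auto
  note dist = hex_dist_def hex_height_def v p fst_conv snd_conv i_def[symmetric]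
  show ?thesis
  proof (cases "even (x + y)")
    case True
    have m: "(x + y) mod 2 = 0" "(x - 1 + y) mod 2 = 1" "(x + 1 + y) mod 2 = 1"
      "(x + (y + 1)) mod 2 = 1"
      using True by presburger+
    \<comment> \<open>A sideways step lowers the height by 1, which for \<open>y \<ge> b\<close>
      hurts only when \<open>p\<close> and \<open>v\<close> have equal height. Then
      \<open>y = b\<close> and \<open>i = 0\<close>, and parity makes the column offset even, hence
      not 1. In the second fact \<open>p\<close> lies just above \<open>v\<close> without an edge
      between them; \<open>i = 1\<close> makes the height difference 3, which leaves room for the
      detour.\<close>
    have near: "y = b \<Longrightarrow> i = 0 \<Longrightarrow> x \<noteq> a + 1 \<and> x \<noteq> a - 1"
      "x = a \<Longrightarrow> y = b + 1 \<Longrightarrow> i = 1"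
      using True unfolding i_def by presburger+
    have edges: "((x - 1, y), p) \<in> HEX" "((x + 1, y), p) \<in> HEX" "((x, y + 1), p) \<in> HEX"
      using True by (auto simp: HEX_def p)
    consider "y < b" | "y \<ge> b" "x > a" | "y \<ge> b" "x < a" | "y > b" "x = a"
      using ne by linarith
    then show ?thesis
    proof cases
      case 1
      then have "hex_dist v (x, y + 1) < hex_dist v p"
        unfolding dist m using i by auto
      with edges show ?thesis by blast
    next
      case 2
      then have "hex_dist v (x - 1, y) < hex_dist v p"
        unfolding dist m using i near(1) by (cases "y = b") auto
      with edges show ?thesis by blast
    next
      case 3
      then have "hex_dist v (x + 1, y) < hex_dist v p"
        unfolding dist m using i near(1) by (cases "y = b") auto
      with edges show ?thesis by blast
    next
      \<comment> \<open>The vertical edge leads away from \<open>v\<close>. The sideways step raises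
        the taxicab distance by 1 but lowers the height term, which is the larger one here.\<close>
      case 4
      then have "hex_dist v (x + 1, y) < hex_dist v p"
        unfolding dist m using i near(2) by (cases "y = b + 1") auto
      with edges show ?thesis by blast
    qed
  next
    case False
    \<comment> \<open>Mirror image of the even case: the vertical edge now points down.\<close>
    have m: "(x + y) mod 2 = 1" "(x - 1 + y) mod 2 = 0" "(x + 1 + y) mod 2 = 0"
      "(x + (y - 1)) mod 2 = 0"
      using False by presburger+
    have near: "y = b \<Longrightarrow> i = 1 \<Longrightarrow> x \<noteq> a + 1 \<and> x \<noteq> a - 1"
      "x = a \<Longrightarrow> y = b - 1 \<Longrightarrow> i = 0"
      using False unfolding i_def by presburger+
    have edges: "((x - 1, y), p) \<in> HEX" "((x + 1, y), p) \<in> HEX" "((x, y - 1), p) \<in> HEX"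
      using False by (auto simp: HEX_def p)
    consider "y > b" | "y \<le> b" "x > a" | "y \<le> b" "x < a" | "y < b" "x = a"
      using ne by linarith
    then show ?thesis
    proof cases
      case 1
      then have "hex_dist v (x, y - 1) < hex_dist v p"
        unfolding dist m using i by auto
      with edges show ?thesis by blast
    next
      case 2
      then have "hex_dist v (x - 1, y) < hex_dist v p"
        unfolding dist m using i near(1) by (cases "y = b") auto
      with edges show ?thesis by blast
    next
      case 3
      then have "hex_dist v (x + 1, y) < hex_dist v p"
        unfolding dist m using i near(1) by (cases "y = b") auto
      with edges show ?thesis by blast
    next
      case 4
      then have "hex_dist v (x + 1, y) < hex_dist v p"
        unfolding dist m using i near(2) by (cases "y = b - 1") auto
      with edges show ?thesis by blast
    qed
  qed
qed

text \<open>\<open>hex_dist_edge\<close> bounds the length of every path from below; iterating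
  \<open>hex_dist_descent\<close> builds a path of length at most
  \<open>hex_dist v p\<close>.\<close>

lemma graph_ball_HEX: "graph_ball HEX v r = {p. hex_dist v p \<le> int r}"
proof (intro equalityI subsetI)
  fix p assume "p \<in> graph_ball HEX v r"
  then obtain n where n: "n \<le> r" "(v, p) \<in> HEX ^^ n"
    by (auto simp: graph_ball_def)
  have "(v, p) \<in> HEX ^^ n \<Longrightarrow> hex_dist v p \<le> int n"
  proof (induction n arbitrary: p)
    case 0
    then show ?case by (simp add: hex_dist_def)
  next
    case (Suc n)
    then obtain q where "(v, q) \<in> HEX ^^ n" "(q, p) \<in> HEX" by auto
    with Suc.IH[of q] hex_dist_edge[of q p v] show ?case by simp
  qed
  with n show "p \<in> {p. hex_dist v p \<le> int r}" by simp
next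
  fix p assume "p \<in> {p. hex_dist v p \<le> int r}"
  then have "hex_dist v p \<le> int r" by simp
  then show "p \<in> graph_ball HEX v r"
  proof (induction r arbitrary: p)
    case 0
    then have "p = v"
      by (auto simp: hex_dist_def prod_eq_iff)
    then show ?case by (auto simp: graph_ball_def)
  next
    case (Suc r)
    show ?case
    proof (cases "p = v")
      case True
      then show ?thesis by (auto simp: graph_ball_def intro: exI[of _ 0])
    next
      case False
      then obtain q where q: "(q, p) \<in> HEX" "hex_dist v q < hex_dist v p"
        using hex_dist_descent by blast
      then have "q \<in> graph_ball HEX v r"
        using Suc by simp
      with q show ?thesis
        using nbhd_subset_graph_ball_Suc by (fastforce simp: nbhd_def)
    qed
  qed
qed

section \<open>Quadratic growth of the balls\<close>

definition hexagon :: "int \<times> int \<Rightarrow> nat \<Rightarrow> (int \<times> int) set" where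
  "hexagon v m =
     {p. \<bar>fst p - fst v\<bar> + \<bar>snd p - snd v\<bar> \<le> 2 * int m \<and> \<bar>snd p - snd v\<bar> \<le> int m}"

lemma sum_symmetric_interval:
  "(\<Sum>j = - int m..int m. c - 2 * \<bar>j\<bar>) = (2 * int m + 1) * c - 2 * int m * (int m + 1)"
proof (induction m)
  case 0
  then show ?case by simp
next
  case (Suc m)
  have "{- int (Suc m)..int (Suc m)} =
      insert (- int (Suc m)) (insert (int (Suc m)) {- int m..int m})"
    by auto
  with Suc show ?case by (simp add: algebra_simps)
qed

lemma hexagon_finite_card:
  "finite (hexagon v m)" "card (hexagon v m) = 6 * m\<^sup>2 + 4 * m + 1"
proof -
  \<comment> \<open>Points are listed by rows: the row at offset \<open>j\<close> has
    \<open>4 * int m + 1 - 2 * \<bar>j\<bar>\<close> of them, a positive number, so the later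
    \<open>nat\<close> truncates nothing.\<close>
  let ?T = "SIGMA j:{- int m..int m}. {\<bar>j\<bar> - 2 * int m..2 * int m - \<bar>j\<bar>}"
  let ?f = "\<lambda>(j, i). (fst v + i, snd v + j)"
  have img: "hexagon v m = ?f ` ?T"
  proof (intro equalityI subsetI)
    fix p assume "p \<in> hexagon v m"
    then have "(snd p - snd v, fst p - fst v) \<in> ?T"
      by (auto simp: hexagon_def)
    then show "p \<in> ?f ` ?T"
      by (rule rev_image_eqI) simp
  qed (auto simp: hexagon_def)
  have inj: "inj_on ?f ?T"
    by (auto simp: inj_on_def)
  show "finite (hexagon v m)"
    unfolding img by simp
  have "int (card (hexagon v m)) = int (card ?T)"
    unfolding img by (simp add: card_image[OF inj])
  also have "\<dots> = (\<Sum>j = - int m..int m. int (nat (4 * int m + 1 - 2 * \<bar>j\<bar>)))"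
    by (simp add: card_SigmaI algebra_simps)
  also have "\<dots> = (\<Sum>j = - int m..int m. (4 * int m + 1) - 2 * \<bar>j\<bar>)"
    by (intro sum.cong) auto
  also have "\<dots> = int (6 * m\<^sup>2 + 4 * m + 1)"
    unfolding sum_symmetric_interval by (simp add: algebra_simps power2_eq_square)
  finally show "card (hexagon v m) = 6 * m\<^sup>2 + 4 * m + 1"
    by linarith
qed

text \<open>Both parity corrections are 0 or 1. This trades bounds on the height for bounds on the
  row.\<close>

lemma hex_height_diff: "\<bar>hex_height p - hex_height v - 2 * (snd p - snd v)\<bar> \<le> 1"
  unfolding hex_height_def by presburger

lemma graph_ball_HEX_subset_hexagon: "graph_ball HEX v r \<subseteq> hexagon v (r div 2 + 1)"
proof
  fix p assume "p \<in> graph_ball HEX v r"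
  then have "\<bar>fst p - fst v\<bar> + \<bar>snd p - snd v\<bar> \<le> int r" "\<bar>hex_height p - hex_height v\<bar> \<le> int r"
    by (auto simp: graph_ball_HEX hex_dist_def)
  moreover have "int r \<le> 2 * int (r div 2) + 1" by linarith
  ultimately have "\<bar>fst p - fst v\<bar> + \<bar>snd p - snd v\<bar> \<le> 2 * int (r div 2 + 1)"
    "\<bar>snd p - snd v\<bar> \<le> int (r div 2 + 1)"
    using hex_height_diff[of p v] by (smt (verit) of_nat_add of_nat_1)+
  then show "p \<in> hexagon v (r div 2 + 1)" by (simp add: hexagon_def)
qed

text \<open>The parity correction can push the height difference to \<open>2 * m + 1\<close>, hence
  that radius.\<close>

lemma hexagon_subset_graph_ball_HEX: "hexagon v m \<subseteq> graph_ball HEX v (2 * m + 1)"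
proof
  fix p assume "p \<in> hexagon v m"
  then have "\<bar>fst p - fst v\<bar> + \<bar>snd p - snd v\<bar> \<le> 2 * int m" "\<bar>snd p - snd v\<bar> \<le> int m"
    by (auto simp: hexagon_def)
  then have "hex_dist v p \<le> 2 * int m + 1"
    using hex_height_diff[of p v] unfolding hex_dist_def by (smt (verit))
  then show "p \<in> graph_ball HEX v (2 * m + 1)"
    by (simp add: graph_ball_HEX)
qed

lemma finite_graph_ball_HEX: "finite (graph_ball HEX v r)"
  using graph_ball_HEX_subset_hexagon hexagon_finite_card(1) by (rule finite_subset)

lemma card_graph_ball_HEX_pos: "card (graph_ball HEX v r) > 0"
proof -
  have "v \<in> graph_ball HEX v r"
    by (simp add: graph_ball_HEX hex_dist_def)
  then show ?thesis
    using finite_graph_ball_HEX by (auto simp: card_gt_0_iff)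
qed

text \<open>The larger ball fits in a hexagon and the smaller one contains a hexagon; their
  parameters differ by 3, so both sizes have the same quadratic leading term.\<close>

lemma card_graph_ball_HEX_ratio:
  "(\<lambda>r. real (card (graph_ball HEX v (Suc r))) / real (card (graph_ball HEX v r))) \<longlonglongrightarrow> 1"
proof (rule tendsto_sandwich)
  define q where "q m = 6 * (real m)\<^sup>2 + 4 * real m + 1" for m
  let ?b = "\<lambda>r. real (card (graph_ball HEX v r))"
  have q: "q m = real (card (hexagon v m))" for m
    by (simp add: q_def hexagon_finite_card)
  have upper: "?b (Suc r) \<le> q (r div 2 + 2)" for r
  proof -
    have "?b (Suc r) \<le> q (Suc r div 2 + 1)"
      unfolding q using card_mono[OF hexagon_finite_card(1) graph_ball_HEX_subset_hexagon] by simp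
    also have "\<dots> \<le> q (r div 2 + 2)"
      unfolding q_def by (intro add_mono mult_left_mono power_mono) auto
    finally show ?thesis .
  qed
  \<comment> \<open>\<open>r \<ge> 2\<close> keeps \<open>r div 2 - 1\<close> from
    truncating.\<close>
  have lower: "q (r div 2 - 1) \<le> ?b r" if "r \<ge> 2" for r
  proof -
    have "hexagon v (r div 2 - 1) \<subseteq> graph_ball HEX v r"
      using hexagon_subset_graph_ball_HEX graph_ball_mono[of "2 * (r div 2 - 1) + 1" r HEX v] that
      by fastforce
    then show ?thesis
      unfolding q by (simp add: card_mono finite_graph_ball_HEX)
  qed
  show "\<forall>\<^sub>F r in sequentially. 1 \<le> ?b (Suc r) / ?b r"
    using card_graph_ball_HEX_pos card_mono[OF finite_graph_ball_HEX graph_ball_mono[of _ "Suc _"]]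
    by (intro always_eventually allI) simp
  show "\<forall>\<^sub>F r in sequentially. ?b (Suc r) / ?b r \<le> q (r div 2 + 2) / q (r div 2 - 1)"
    using eventually_ge_at_top[of 2]
  proof eventually_elim
    case (elim r)
    have "q (r div 2 - 1) > 0"
      unfolding q_def by (simp add: add_nonneg_pos)
    then show ?case
      using upper[of r] lower[OF elim] by (intro frac_le) auto
  qed
  have "(\<lambda>m. q (m + 2) / q (m - 1)) \<longlonglongrightarrow> 1"
  \<comment> \<open>The shift removes the truncated subtraction and leaves a rational function of
    \<open>m\<close>.\<close>
  proof (rule LIMSEQ_imp_Suc)
    show "(\<lambda>m. q (Suc m + 2) / q (Suc m - 1)) \<longlonglongrightarrow> 1"
      unfolding q_def by simp real_asymp
  qed
  moreover have "filterlim (\<lambda>r::nat. r div 2) at_top sequentially"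
    by (simp add: filterlim_at_top_div_const_nat)
  ultimately show "(\<lambda>r. q (r div 2 + 2) / q (r div 2 - 1)) \<longlonglongrightarrow> 1"
    by (rule filterlim_compose)
qed auto

section \<open>The optimal density\<close>

lemma RED_LD_set_HEX_density_ge:
  assumes "RED_LD_set HEX S"
  shows "1 / 2 \<le> graph_density HEX S"
proof -
  \<comment> \<open>The density is a supremum over centres, so one centre suffices for a lower
    bound.\<close>
  define v :: "int \<times> int" where "v = 0"
  let ?b = "\<lambda>r. real (card (graph_ball HEX v r))"
  let ?f = "\<lambda>r. real (card (S \<inter> graph_ball HEX v r)) / ?b r"
  \<comment> \<open>The counting bound compares radii \<open>r\<close> and \<open>Suc r\<close>, so
    the ratio of ball sizes enters inverted.\<close>
  have le: "inverse (?b (Suc r) / ?b r) / 2 \<le> ?f (Suc r)" for r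
  proof -
    have "?b r \<le> 2 * real (card (S \<inter> graph_ball HEX v (Suc r)))"
      using RED_LD_set_card_ball[OF assms sym_HEX finite_graph_ball_HEX card_nbhd_HEX, of v r]
      by linarith
    then show ?thesis
      using card_graph_ball_HEX_pos[of v] by (simp add: field_simps)
  qed
  have "(\<lambda>r. inverse (?b (Suc r) / ?b r) / 2) \<longlonglongrightarrow> inverse 1 / 2"
    by (intro tendsto_intros card_graph_ball_HEX_ratio) auto
  then have "(\<lambda>r. ereal (inverse (?b (Suc r) / ?b r) / 2)) \<longlonglongrightarrow> ereal (1 / 2)"
    by simp
  then have "ereal (1 / 2) = limsup (\<lambda>r. ereal (inverse (?b (Suc r) / ?b r) / 2))"
    by (intro lim_imp_Limsup[symmetric]) auto
  also have "\<dots> \<le> limsup (\<lambda>r. ereal (?f (Suc r)))"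
    using le by (intro Limsup_mono always_eventually) auto
  also have "\<dots> = limsup (\<lambda>r. ereal (?f r))"
    using limsup_shift[of "\<lambda>r. ereal (?f r)"] by simp
  also have "\<dots> \<le> graph_density HEX S"
    unfolding graph_density_def by (rule SUP_upper) simp
  finally show ?thesis by (simp add: one_ereal_def)
qed

section \<open>The extremal set of even columns\<close>

definition even_columns :: "(int \<times> int) set" where
  "even_columns = {p. even (fst p)}"

lemma RED_LD_set_even_columns: "RED_LD_set HEX even_columns"
proof -
  \<comment> \<open>Empty \<open>W\<close> gives the LD property, singleton \<open>W\<close> its
    redundancy.\<close>
  have "LD_set HEX (even_columns - W)" if W: "W = {} \<or> (\<exists>w\<in>even_columns. W = {w})" for W
  proof -
    let ?N = "\<lambda>p. nbhd HEX p \<inter> (even_columns - W)"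
    have odd: "?N (x, y) = {(x - 1, y), (x + 1, y)} - W" if "odd x" for x y
      using that by (auto simp: nbhd_HEX even_columns_def)
    have removed: "?N (x, y) = {(x, if even (x + y) then y + 1 else y - 1)}"
      if "(x, y) \<in> W" for x y
      using that W by (auto simp: nbhd_HEX even_columns_def)
    have cases: "odd (fst p) \<or> W = {p}" if "p \<notin> even_columns - W" for p
      using that W by (auto simp: even_columns_def)
    have nonempty: "?N p \<noteq> {}" if "p \<notin> even_columns - W" for p
    proof (cases p)
      case (Pair x y)
      from cases[OF that] show ?thesis
      proof
        assume "odd (fst p)"
        then show ?thesis using W unfolding Pair by (subst odd) auto
      next
        assume "W = {p}"
        then show ?thesis unfolding Pair by (subst removed) auto
      qed
    qed
    have odd_odd: "(a, b) = (x, y)" if "odd a" "odd x" "?N (a, b) = ?N (x, y)" for a b x y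
    proof -
      \<comment> \<open>Two distinct two-point sets differ in at least two points, so deleting at
        most one point cannot make them equal. Each pair determines its odd vertex as
        midpoint.\<close>
      obtain w where W': "z \<in> W \<longrightarrow> z = w" for z using W by blast
      have "z \<in> {(a - 1, b), (a + 1, b)} - W \<longleftrightarrow> z \<in> {(x - 1, y), (x + 1, y)} - W" for z
        using that odd by metis
      from this[of "(a - 1, b)"] this[of "(a + 1, b)"] this[of "(x - 1, y)"] this[of "(x + 1, y)"]
      show ?thesis
        using W'[of "(a - 1, b)"] W'[of "(a + 1, b)"] W'[of "(x - 1, y)"] W'[of "(x + 1, y)"]
        by (cases "a = x"; cases "b = y") auto
    qed
    \<comment> \<open>The only neighbour of the removed detector that is left lies in another row.\<close>
    have odd_removed: "?N (a, b) \<noteq> ?N (x, y)" if "odd a" "W = {(x, y)}" for a b x y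
    proof
      assume "?N (a, b) = ?N (x, y)"
      then have "z \<in> {(a - 1, b), (a + 1, b)} - W \<longleftrightarrow>
          z \<in> {(x, if even (x + y) then y + 1 else y - 1)}" for z
        using that odd[of a b] removed[of x y] by (metis singletonI)
      from this[of "(a - 1, b)"] this[of "(a + 1, b)"] show False
        using \<open>W = {(x, y)}\<close> by (auto split: if_splits)
    qed
    have "u = v" if "u \<notin> even_columns - W" "v \<notin> even_columns - W" "?N u = ?N v" for u v
      using cases[OF that(1)] cases[OF that(2)] that(3) odd_odd odd_removed
      by (metis prod.collapse singleton_inject)
    with nonempty show ?thesis unfolding LD_set_def by metis
  qed
  from this[of "{}"] this[of "{_}"] show ?thesis
    unfolding RED_LD_set_def by auto
qed

text \<open>Moving one column to the right follows an edge and sends even columns injectively into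
  odd ones, so the detectors and their images are disjoint within the next larger ball.\<close>

lemma card_even_columns_ball:
  "2 * card (even_columns \<inter> graph_ball HEX v r) \<le> card (graph_ball HEX v (Suc r))"
proof -
  let ?A = "even_columns \<inter> graph_ball HEX v r"
  let ?h = "\<lambda>p. (fst p + 1, snd p) :: int \<times> int"
  have inj: "inj_on ?h ?A"
    by (auto simp: inj_on_def prod_eq_iff)
  have "?h p \<in> graph_ball HEX v (Suc r)" if "p \<in> graph_ball HEX v r" for p
    using nbhd_subset_graph_ball_Suc[OF that] by (cases p) (simp add: nbhd_HEX)
  then have "?A \<union> ?h ` ?A \<subseteq> graph_ball HEX v (Suc r)"
    using graph_ball_mono[of r "Suc r" HEX v] by auto
  then have "card (?A \<union> ?h ` ?A) \<le> card (graph_ball HEX v (Suc r))"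
    by (intro card_mono finite_graph_ball_HEX)
  moreover have "card (?A \<union> ?h ` ?A) = card ?A + card (?h ` ?A)"
    using finite_graph_ball_HEX by (intro card_Un_disjoint) (auto simp: even_columns_def)
  ultimately show ?thesis
    by (simp add: card_image[OF inj])
qed

lemma density_even_columns_le: "graph_density HEX even_columns \<le> 1 / 2"
  unfolding graph_density_def
proof (rule SUP_least)
  \<comment> \<open>The ratio limit holds at every centre, so the bound passes to the
    supremum.\<close>
  fix v :: "int \<times> int"
  let ?b = "\<lambda>r. real (card (graph_ball HEX v r))"
  have "real (card (even_columns \<inter> graph_ball HEX v r)) / ?b r \<le> ?b (Suc r) / ?b r / 2" for r
    using card_even_columns_ball[of v r] card_graph_ball_HEX_pos[of v r]
    by (simp add: field_simps)
  then have "limsup (\<lambda>r. ereal (real (card (even_columns \<inter> graph_ball HEX v r)) / ?b r))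
      \<le> limsup (\<lambda>r. ereal (?b (Suc r) / ?b r / 2))"
    by (intro Limsup_mono always_eventually) auto
  also have "(\<lambda>r. ereal (?b (Suc r) / ?b r / 2)) \<longlonglongrightarrow> ereal (1 / 2)"
    using tendsto_divide[OF card_graph_ball_HEX_ratio[of v] tendsto_const[of 2]] by simp
  then have "limsup (\<lambda>r. ereal (?b (Suc r) / ?b r / 2)) = ereal (1 / 2)"
    by (intro lim_imp_Limsup) auto
  finally show "limsup (\<lambda>r. ereal (real (card (even_columns \<inter> graph_ball HEX v r)) / ?b r)) \<le> 1 / 2"
    by (simp add: one_ereal_def)
qed

theorem theorem18: "is_RED_LD_density HEX (1 / 2)"
  unfolding is_RED_LD_density_def
  using RED_LD_set_even_columns density_even_columns_le RED_LD_set_HEX_density_ge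
  by (blast intro: antisym)

end
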